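(* Let $m,n\in\mathbb{N}$ with $m<n$, let $M\in\mathbb{R}^{m\times n}$ have full rank, let $p\in\mathbb{R}^m$, let $s\le n$, and set $A_s=\{x\in\mathbb{R}^n : \|x\|_0\le s\}$ and $B=\{x\in\mathbb{R}^n : Mx=p\}$. Suppose $A_s\cap B\ne\emptyset$ and let $\bar x\in A_s\cap B$ with $\|\bar x\|_0=s$. Choose $\delta$ with $0<\delta<\min\{|\bar x_j| : \bar x_j\ne0\}$, and let $T_{DR}=\frac12(R_{A_s}R_B+\mathrm{Id})$. Then for every $x^0\in\mathbb{B}_{\delta/2}(\bar x)$ the corresponding Douglas-Rachford iterates $x^{k+1}\in T_{DR}x^k$ $(k\in\mathbb{N})$ converge with linear rate to $\mathrm{Fix}\,T_{DR}$, that is, there are constants $C\ge0$ and $c\in[0,1)$ with $d_{\mathrm{Fix}\,T_{DR}}(x^k)\le C c^k$ for all $k\in\mathbb{N}$. Moreover, for any $\hat x\in \mathrm{Fix}\,T_{DR}\cap\mathbb{B}_{\delta/2}(\bar x)$ we have $P_B\hat x\in A_s\cap B$.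
   Context: $\|x\|_0$ is the number of nonzero entries of $x$; norms without subscript are Euclidean; $\mathbb{N}$ denotes the nonnegative integers; $\mathbb{B}_r(\bar x)$ is the closed ball of radius $r$ centered at $\bar x$; $d_\Omega(x)=\inf_{y\in\Omega}\|x-y\|$. For a closed nonempty set $\Omega$, the (possibly set-valued) projector is $P_\Omega(x)=\operatorname{argmin}_{y\in\Omega}\|x-y\|$ and the reflector is $R_\Omega(x)=2P_\Omega(x)-x$. For a possibly set-valued self-mapping $T$, $\mathrm{Fix}\,T=\{x : x\in Tx\}$. The minimum over an empty set is $+\infty$. *)

theory Defs
  imports "HOL-Analysis.Analysis"
begin

definition l0_norm :: "real^'n \<Rightarrow> nat" where
  "l0_norm x = card {j. x $ j \<noteq> 0}"

definition sparse_set :: "nat \<Rightarrow> (real^'n) set" where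
  "sparse_set s = {x. l0_norm x \<le> s}"

text \<open>
  An $m \times n$ matrix is represented by its rows \<open>M 0, \<dots>, M (m - 1)\<close> in \<open>real^'n\<close>, and a vector
  of $\mathbb{R}^m$ by its entries \<open>p 0, \<dots>, p (m - 1)\<close>; values at indices \<open>\<ge> m\<close> are never used.
  Unlike \<open>real^'n^'m\<close>, this includes $m = 0$ (no equations). The rank below is the
  dimension of the span of the rows, as for \<^const>\<open>rank\<close>, and the equations are the components of
  the matrix-vector product, as for \<^const>\<open>matrix_vector_mult\<close>.
\<close>

definition mat_rank :: "nat \<Rightarrow> (nat \<Rightarrow> real^'n) \<Rightarrow> nat" where
  "mat_rank m M = dim {M i | i. i < m}"

definition full_rank :: "nat \<Rightarrow> (nat \<Rightarrow> real^'n) \<Rightarrow> bool" where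
  "full_rank m M \<longleftrightarrow> mat_rank m M = min m CARD('n)"

definition solution_set :: "nat \<Rightarrow> (nat \<Rightarrow> real^'n) \<Rightarrow> (nat \<Rightarrow> real) \<Rightarrow> (real^'n) set" where
  "solution_set m M p = {x. \<forall>i<m. (\<Sum>j\<in>UNIV. M i $ j * x $ j) = p i}"

text \<open>Set-valued maps are functions into sets.\<close>

definition projector :: "'a::real_normed_vector set \<Rightarrow> 'a \<Rightarrow> 'a set" where
  "projector \<Omega> x = {y. is_arg_min (\<lambda>y. norm (x - y)) (\<lambda>y. y \<in> \<Omega>) y}"

definition reflector :: "'a::real_normed_vector set \<Rightarrow> 'a \<Rightarrow> 'a set" where
  "reflector \<Omega> x = {2 *\<^sub>R y - x | y. y \<in> projector \<Omega> x}"

definition douglas_rachford ::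
  "'a::real_normed_vector set \<Rightarrow> 'a set \<Rightarrow> 'a \<Rightarrow> 'a set" where
  "douglas_rachford A B x =
     {(1/2) *\<^sub>R (z + x) | y z. y \<in> reflector B x \<and> z \<in> reflector A y}"

definition Fix :: "('a \<Rightarrow> 'a set) \<Rightarrow> 'a set" where
  "Fix T = {x. x \<in> T x}"

text \<open>
  The nonemptiness condition is needed because \<open>infdist x {} = 0\<close>, whereas mathematically the
  distance to the empty set is $+\infty$.
\<close>

definition converges_linearly_to :: "(nat \<Rightarrow> 'a::metric_space) \<Rightarrow> 'a set \<Rightarrow> bool" where
  "converges_linearly_to x S \<longleftrightarrow>
     S \<noteq> {} \<and>
     (\<exists>C c :: real. 0 \<le> C \<and> 0 \<le> c \<and> c < 1 \<and> (\<forall>k. infdist (x k) S \<le> C * c ^ k))"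

end

theory Submission
  imports Defs
begin

text \<open>
  Near $\bar x$ the $s$ largest entries of a point sit exactly on the support $I$ of $\bar x$, so
  there $P_{A_s}$ is the orthogonal projector onto the coordinate subspace $L = \mathbb{R}^I$. Both
  reflectors are then linear isometries around $\bar x$, and $T_{DR}$ acts as $T = (S + \mathrm{Id})/2$
  with $S$ orthogonal. The orthogonal complement of $\mathrm{Fix}\,S$ is invariant under $T$, and
  strict convexity of the norm together with compactness of the sphere makes $T$ a contraction on it.
  So the iterates converge linearly to $\bar x + f$, where $f$ is the component of $x^0 - \bar x$
  in $\mathrm{Fix}\,S$; it stays in the ball because $\|f\| \le \|x^0 - \bar x\|$.
\<close>

section \<open>Orthogonal projectors onto subspaces\<close>

text \<open>A single-valued counterpart of the set-valued \<open>projector\<close>: when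
  \<open>V\<close> is a subspace, membership and orthogonality of the residual determine
  \<open>P x\<close>.\<close>

definition orthogonal_projector :: "'a::euclidean_space set \<Rightarrow> ('a \<Rightarrow> 'a) \<Rightarrow> bool" where
  "orthogonal_projector V P \<longleftrightarrow>
     linear P \<and> (\<forall>x. P x \<in> V) \<and> (\<forall>x. \<forall>v\<in>V. v \<bullet> (x - P x) = 0)"

text \<open>Linearity comes from uniqueness: sums and multiples of the chosen points satisfy the
  same membership and orthogonality conditions as the value of \<open>P\<close> at the sum or
  multiple.\<close>

lemma orthogonal_projector_exists:
  fixes V :: "'a::euclidean_space set"
  assumes V: "subspace V"
  shows "\<exists>P. orthogonal_projector V P"
proof -
  have "\<exists>u\<in>V. \<forall>v\<in>V. v \<bullet> (x - u) = 0" for x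
  proof -
    obtain u w where "u \<in> span V" "\<And>v. v \<in> span V \<Longrightarrow> orthogonal w v" "x = u + w"
      using orthogonal_subspace_decomp_exists[of V x] by blast
    then show ?thesis
      using V by (intro bexI[of _ u]) (auto simp: orthogonal_def inner_commute[of _ w] span_eq_iff[THEN iffD2])
  qed
  then obtain P where P: "\<And>x. P x \<in> V" and orth: "\<And>x v. v \<in> V \<Longrightarrow> v \<bullet> (x - P x) = 0"
    by metis
  have uniq: "u = P x" if "u \<in> V" and "\<And>v. v \<in> V \<Longrightarrow> v \<bullet> (x - u) = 0" for u x
  proof -
    have "u - P x \<in> V" using that(1) P V by (simp add: subspace_diff)
    then have "(u - P x) \<bullet> (u - P x) = 0"
      using that(2)[of "u - P x"] orth[of "u - P x" x] by (simp add: inner_diff_right)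
    then show ?thesis by simp
  qed
  have "linear P"
  proof (rule linearI)
    show "P (x + y) = P x + P y" for x y
      using orth[of _ x] orth[of _ y] V P
      by (intro uniq[symmetric]) (auto simp: subspace_add inner_diff_right inner_add_right)
    show "P (c *\<^sub>R x) = c *\<^sub>R P x" for c x
      using orth[of _ x] V P
      by (intro uniq[symmetric]) (auto simp: subspace_scale inner_diff_right)
  qed
  then show ?thesis
    using P orth unfolding orthogonal_projector_def by blast
qed

text \<open>The map keeps \<open>P x\<close> and flips the sign of the residual
  \<open>x - P x\<close>; these two are orthogonal, so the norm is preserved.\<close>

lemma orthogonal_transformation_reflection:
  assumes P: "orthogonal_projector V P"
  shows "orthogonal_transformation (\<lambda>x. 2 *\<^sub>R P x - x)"
proof -
  have "linear P" using P by (simp add: orthogonal_projector_def)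
  then have "linear (\<lambda>x. 2 *\<^sub>R P x - x)"
    by (intro linear_compose_sub linear_compose_scale_right linear_ident)
  moreover have "norm (2 *\<^sub>R P x - x) = norm x" for x
  proof -
    have "P x \<bullet> (x - P x) = 0" using P by (auto simp: orthogonal_projector_def)
    then have "(2 *\<^sub>R P x - x) \<bullet> (2 *\<^sub>R P x - x) = x \<bullet> x"
      by (simp add: inner_diff_left inner_diff_right inner_commute)
    then show ?thesis by (simp add: norm_eq_sqrt_inner)
  qed
  ultimately show ?thesis by (simp add: orthogonal_transformation)
qed

text \<open>By Pythagoras at the foot point \<open>q\<close>, any other point of the affine subspace
  is farther from \<open>x\<close> by exactly its squared distance to \<open>q\<close>.\<close>

lemma projector_affine:
  fixes V :: "'a::euclidean_space set"
  assumes V: "subspace V" and P: "orthogonal_projector V P"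
  shows "projector ((+) a ` V) x = {a + P (x - a)}"
proof -
  define q where "q = a + P (x - a)"
  have PV: "P (x - a) \<in> V" using P by (simp add: orthogonal_projector_def)
  then have qV: "q \<in> (+) a ` V" by (simp add: q_def)
  have pyth: "norm (x - y)^2 = norm (x - q)^2 + norm (q - y)^2" if y: "y \<in> (+) a ` V" for y
  proof -
    obtain v where v: "y = a + v" "v \<in> V" using y by blast
    then have "q - y \<in> V" using PV V by (simp add: q_def subspace_diff)
    then have "(q - y) \<bullet> ((x - a) - P (x - a)) = 0"
      using P unfolding orthogonal_projector_def by blast
    then have "(q - y) \<bullet> (x - q) = 0" by (simp add: q_def algebra_simps)
    then have "norm ((x - q) + (q - y))^2 = norm (x - q)^2 + norm (q - y)^2"
      by (intro norm_add_Pythagorean) (simp add: orthogonal_def inner_commute)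
    then show ?thesis by simp
  qed
  have "y = q" if "is_arg_min (\<lambda>y. norm (x - y)) (\<lambda>y. y \<in> (+) a ` V) y" for y
  proof -
    have y: "y \<in> (+) a ` V" and "norm (x - y) \<le> norm (x - q)"
      using that qV by (auto simp: is_arg_min_linorder)
    then have "norm (x - y)^2 \<le> norm (x - q)^2" by (simp add: power_mono)
    then show ?thesis using pyth[OF y] by simp
  qed
  moreover have "norm (x - q) \<le> norm (x - y)" if "y \<in> (+) a ` V" for y
    by (rule power2_le_imp_le) (simp_all add: pyth[OF that])
  then have "is_arg_min (\<lambda>y. norm (x - y)) (\<lambda>y. y \<in> (+) a ` V) q"
    using qV by (simp add: is_arg_min_linorder)
  ultimately show ?thesis unfolding projector_def q_def by blast
qed

lemma reflector_affine:
  fixes V :: "'a::euclidean_space set"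
  assumes "subspace V" and "orthogonal_projector V P"
  shows "reflector ((+) a ` V) x = {a + (2 *\<^sub>R P (x - a) - (x - a))}"
proof -
  have "2 *\<^sub>R (a + P (x - a)) - x = a + (2 *\<^sub>R P (x - a) - (x - a))"
    by (simp add: scaleR_2)
  then show ?thesis by (simp add: reflector_def projector_affine[OF assms])
qed

section \<open>Averages of an orthogonal transformation and the identity\<close>

lemma orthogonal_average_contraction:
  fixes S :: "'a::euclidean_space \<Rightarrow> 'a"
  assumes S: "orthogonal_transformation S"
  defines "W \<equiv> {w. \<forall>f. S f = f \<longrightarrow> f \<bullet> w = 0}"
  shows "\<exists>c. 0 \<le> c \<and> c < 1 \<and>
           (\<forall>w\<in>W. (1/2) *\<^sub>R (S w + w) \<in> W \<and> norm ((1/2) *\<^sub>R (S w + w)) \<le> c * norm w)"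
proof -
  define T where "T w = (1/2) *\<^sub>R (S w + w)" for w
  have lin: "linear S" and inn: "\<And>x y. S x \<bullet> S y = x \<bullet> y"
    using S by (auto simp: orthogonal_transformation_def)
  have inv: "T w \<in> W" if "w \<in> W" for w
  proof -
    \<comment> \<open>Replace \<open>f\<close> by \<open>S f\<close> on the left; \<open>S\<close>
      preserves inner products.\<close>
    have "f \<bullet> S w = f \<bullet> w" if "S f = f" for f
      using inn[of f w] that by simp
    then show ?thesis using that by (auto simp: W_def T_def inner_add_right)
  qed
  have subW: "subspace W"
    by (auto simp: subspace_def W_def inner_add_right)
  have linT: "linear T"
    unfolding T_def
    by (intro linear_compose_scale_right linear_compose_add lin linear_ident)
  have less: "norm (T w) < norm w" if "w \<in> W" "w \<noteq> 0" for w
  proof -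
    \<comment> \<open>A fixed vector in \<open>W\<close> would be orthogonal to itself.\<close>
    have "S w \<noteq> w" using that by (auto simp: W_def)
    \<comment> \<open>The parallelogram law for \<open>S w\<close> and \<open>w\<close>, which have
      equal norm; it measures the exact loss of norm under \<open>T\<close>.\<close>
    have "norm (T w)^2 + norm ((1/2) *\<^sub>R (S w - w))^2 = norm w^2"
      using inn[of w w]
      unfolding T_def power2_norm_eq_inner
      by (simp add: inner_add_left inner_add_right inner_diff_left
          inner_diff_right inner_commute field_simps)
    moreover have "norm ((1/2) *\<^sub>R (S w - w))^2 > 0" using \<open>S w \<noteq> w\<close> by simp
    ultimately have "norm (T w)^2 < norm w^2" by linarith
    then show ?thesis by (rule power_less_imp_less_base) simp
  qed
  have "\<exists>c. 0 \<le> c \<and> c < 1 \<and> (\<forall>w\<in>W. norm (T w) \<le> c * norm w)"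
  proof (cases "W \<subseteq> {0}")
    case True
    then show ?thesis using linear_0[OF linT] by (intro exI[of _ 0]) auto
  next
    case False
    then obtain w0 where w0: "w0 \<in> W" "w0 \<noteq> 0" by blast
    let ?K = "W \<inter> sphere 0 1"
    have "compact ?K"
      using closed_subspace[OF subW] by (intro closed_Int_compact compact_sphere)
    moreover have "(1 / norm w0) *\<^sub>R w0 \<in> ?K"
      using w0 subspace_scale[OF subW] by simp
    then have "?K \<noteq> {}" by blast
    moreover have "continuous_on ?K (\<lambda>w. norm (T w))"
      using linT by (intro continuous_on_norm linear_continuous_on linear_conv_bounded_linear[THEN iffD1])
    \<comment> \<open>The norm of \<open>T\<close> attains its maximum on the unit vectors of
      \<open>W\<close> at \<open>u\<close>; this maximum is the contraction constant, and
      \<open>less\<close> puts it below 1.\<close>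
    ultimately obtain u where u: "u \<in> ?K" and max: "\<And>w. w \<in> ?K \<Longrightarrow> norm (T w) \<le> norm (T u)"
      using continuous_attains_sup[of ?K "\<lambda>w. norm (T w)"] by blast
    have "norm (T w) \<le> norm (T u) * norm w" if "w \<in> W" for w
    proof (cases "w = 0")
      case False
      then have "(1 / norm w) *\<^sub>R w \<in> ?K"
        using that subspace_scale[OF subW] by simp
      from max[OF this] have "norm (T w) / norm w \<le> norm (T u)"
        by (simp add: linear_scale[OF linT])
      then show ?thesis using False by (simp add: divide_le_eq)
    qed (simp add: linear_0[OF linT])
    moreover have "norm (T u) < 1" using less[of u] u by (cases "u = 0") auto
    ultimately show ?thesis by (intro exI[of _ "norm (T u)"]) auto
  qed
  then show ?thesis using inv by (auto simp: T_def)
qed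

text \<open>This keeps the iterates inside the ball on which the reflectors are known
  explicitly.\<close>

lemma norm_average_le:
  assumes "orthogonal_transformation S"
  shows "norm ((1/2) *\<^sub>R (S v + v)) \<le> norm v"
proof -
  have "norm (S v + v) \<le> norm v + norm v"
    using norm_triangle_ineq[of "S v" v] orthogonal_transformation_norm[OF assms, of v] by simp
  then show ?thesis by simp
qed

text \<open>Split \<open>v 0\<close> into its projection \<open>f\<close> onto the fixed space of
  \<open>S\<close> and an orthogonal rest: the iteration leaves \<open>f\<close> alone and contracts
  the rest. The bound on \<open>norm f\<close> later places the limit in the ball.\<close>

lemma orthogonal_average_iterates:
  fixes S :: "'a::euclidean_space \<Rightarrow> 'a"
  assumes S: "orthogonal_transformation S"
    and step: "\<And>k. v (Suc k) = (1/2) *\<^sub>R (S (v k) + v k)"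
  shows "\<exists>f c. S f = f \<and> norm f \<le> norm (v 0) \<and> 0 \<le> c \<and> c < 1 \<and>
           (\<forall>k. norm (v k - f) \<le> norm (v 0 - f) * c ^ k)"
proof -
  have lin: "linear S" using S by (simp add: orthogonal_transformation_def)
  define F where "F = {f. S f = f}"
  have "subspace F"
    by (auto simp: subspace_def F_def linear_0[OF lin] linear_add[OF lin] linear_scale[OF lin])
  then obtain P where P: "orthogonal_projector F P"
    using orthogonal_projector_exists by blast
  define f where "f = P (v 0)"
  have f: "S f = f" and orth: "\<And>g. S g = g \<Longrightarrow> g \<bullet> (v 0 - f) = 0"
    using P by (auto simp: orthogonal_projector_def F_def f_def)
  have "norm (f + (v 0 - f))^2 = norm f^2 + norm (v 0 - f)^2"
    using orth[OF f] by (intro norm_add_Pythagorean) (simp add: orthogonal_def)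
  then have "norm f^2 \<le> norm (v 0)^2"
    using zero_le_power2[of "norm (v 0 - f)"] by (simp only: diff_add_cancel add.commute[of f])
  then have nf: "norm f \<le> norm (v 0)" by (rule power2_le_imp_le) simp
  obtain c where c: "0 \<le> c" "c < 1" and
    contr: "\<And>w. \<forall>g. S g = g \<longrightarrow> g \<bullet> w = 0 \<Longrightarrow>
      (\<forall>g. S g = g \<longrightarrow> g \<bullet> ((1/2) *\<^sub>R (S w + w)) = 0) \<and> norm ((1/2) *\<^sub>R (S w + w)) \<le> c * norm w"
    using orthogonal_average_contraction[OF S] by auto
  have "norm (v k - f) \<le> norm (v 0 - f) * c ^ k" for k
  proof -
    \<comment> \<open>The induction carries orthogonality along, since the contraction is available
      only on the orthogonal complement of the fixed space.\<close>
    have "(\<forall>g. S g = g \<longrightarrow> g \<bullet> (v k - f) = 0) \<and> norm (v k - f) \<le> norm (v 0 - f) * c ^ k"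
    proof (induction k)
      case 0
      then show ?case using orth by simp
    next
      case (Suc k)
      have eq: "v (Suc k) - f = (1/2) *\<^sub>R (S (v k - f) + (v k - f))"
        by (simp add: step linear_diff[OF lin] f algebra_simps flip: scaleR_add_left)
      have "norm (v (Suc k) - f) \<le> c * norm (v k - f)"
        unfolding eq using contr[of "v k - f"] Suc by blast
      also have "\<dots> \<le> c * (norm (v 0 - f) * c ^ k)"
        using Suc c by (intro mult_left_mono) auto
      finally have "norm (v (Suc k) - f) \<le> norm (v 0 - f) * c ^ Suc k"
        by (simp add: mult_ac)
      then show ?case unfolding eq using contr[of "v k - f"] Suc by blast
    qed
    then show ?thesis by blast
  qed
  then show ?thesis using f nf c by blast
qed

section \<open>Sparse vectors and the solution set\<close>

lemma subspace_coordinates: "subspace {z :: real^'n. \<forall>j. j \<notin> I \<longrightarrow> z $ j = 0}"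
  by (auto simp: subspace_def)

text \<open>Compare the support \<open>J\<close> of \<open>z\<close> with \<open>I\<close> through
  the shifted weights \<open>(y $ j)^2 - r^2\<close>, which are positive on \<open>I\<close> and
  nonpositive elsewhere. The set \<open>J\<close> is no larger than \<open>I\<close> and misses an
  index of \<open>I\<close>, so it captures strictly less of the mass of \<open>y\<close>.\<close>

lemma coordinate_subspace_closer:
  fixes y z :: "real^'n"
  assumes z: "z \<in> sparse_set (card I)" and supp: "\<exists>j. j \<notin> I \<and> z $ j \<noteq> 0"
    and large: "\<And>j. j \<in> I \<Longrightarrow> r < \<bar>y $ j\<bar>"
    and small: "\<And>j. j \<notin> I \<Longrightarrow> \<bar>y $ j\<bar> \<le> r"
  shows "norm (y - (\<chi> j. if j \<in> I then y $ j else 0)) < norm (y - z)"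
proof -
  define J where "J = {j. z $ j \<noteq> 0}"
  have cJ: "card J \<le> card I" using z by (simp add: sparse_set_def l0_norm_def J_def)
  \<comment> \<open>Inclusion together with \<open>cJ\<close> would force \<open>J = I\<close>, but
    \<open>z\<close> has a nonzero entry outside \<open>I\<close>.\<close>
  have "\<not> I \<subseteq> J"
    using card_seteq[of J I] cJ supp by (auto simp: J_def)
  then obtain i where i: "i \<in> I" "i \<notin> J" by blast
  have r: "0 \<le> r" using supp small by fastforce
  have pos: "0 < (y $ j)^2 - r^2" if "j \<in> I" for j
    using large[OF that] r power_strict_mono[of r "\<bar>y $ j\<bar>" 2] by simp
  have neg: "(y $ j)^2 - r^2 \<le> 0" if "j \<notin> I" for j
    using power_mono[OF small[OF that], of 2] by simp
  have "(\<Sum>j\<in>J. (y $ j)^2 - r^2) \<le> (\<Sum>j\<in>J \<inter> I. (y $ j)^2 - r^2)"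
    using neg sum.Int_Diff[of J "\<lambda>j. (y $ j)^2 - r^2" I] sum_nonpos[of "J - I" "\<lambda>j. (y $ j)^2 - r^2"]
    by simp
  also have "\<dots> < (\<Sum>j\<in>I. (y $ j)^2 - r^2)"
    using i pos by (intro sum_strict_mono2[where b = i]) (auto intro: less_imp_le)
  finally have "(\<Sum>j\<in>J. (y $ j)^2) - card J * r^2 < (\<Sum>j\<in>I. (y $ j)^2) - card I * r^2"
    by (simp add: sum_subtractf)
  \<comment> \<open>Undoes the shift: the smaller set \<open>J\<close> had at most as much
    subtracted.\<close>
  moreover have "real (card J) * r^2 \<le> card I * r^2"
    using cJ by (intro mult_right_mono) auto
  ultimately have lt: "(\<Sum>j\<in>J. (y $ j)^2) < (\<Sum>j\<in>I. (y $ j)^2)" by linarith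
  have split: "(\<Sum>j\<in>-K. (y $ j)^2) = (\<Sum>j\<in>UNIV. (y $ j)^2) - (\<Sum>j\<in>K. (y $ j)^2)" for K
    using sum.subset_diff[of K UNIV "\<lambda>j. (y $ j)^2"] by (simp add: Compl_eq_Diff_UNIV)
  have nrm: "norm w^2 = (\<Sum>j\<in>UNIV. (w $ j)^2)" for w :: "real^'n"
    unfolding power2_norm_eq_inner inner_vec_def by (simp add: power2_eq_square)
  have "norm (y - (\<chi> j. if j \<in> I then y $ j else 0))^2 = (\<Sum>j\<in>UNIV. if j \<in> -I then (y $ j)^2 else 0)"
    unfolding nrm by (intro sum.cong) auto
  also have "\<dots> = (\<Sum>j\<in>-I. (y $ j)^2)"
    by (simp add: sum.If_cases Compl_eq)
  also have "\<dots> < (\<Sum>j\<in>-J. (y $ j)^2)"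
    using lt by (simp add: split)
  \<comment> \<open>Off its support \<open>z\<close> vanishes, so \<open>y - z\<close> agrees with
    \<open>y\<close> there.\<close>
  also have "\<dots> = (\<Sum>j\<in>-J. ((y - z) $ j)^2)"
    by (intro sum.cong) (auto simp: J_def)
  also have "\<dots> \<le> norm (y - z)^2"
    unfolding nrm by (intro sum_mono2) auto
  finally show ?thesis by (rule power_less_imp_less_base) simp
qed

lemma coordinate_subspace_subset_sparse_set:
  fixes I :: "'n::finite set"
  shows "{z :: real^'n. \<forall>j. j \<notin> I \<longrightarrow> z $ j = 0} \<subseteq> sparse_set (card I)"
  by (auto simp: sparse_set_def l0_norm_def intro!: card_mono)

text \<open>Every sparse point outside the coordinate subspace is strictly beaten by the truncation
  \<open>q\<close> of \<open>y\<close> to \<open>I\<close>, which lies inside it. Hence both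
  minimization problems have the same solutions.\<close>

lemma projector_sparse_set:
  fixes y :: "real^'n"
  assumes large: "\<And>j. j \<in> I \<Longrightarrow> r < \<bar>y $ j\<bar>"
    and small: "\<And>j. j \<notin> I \<Longrightarrow> \<bar>y $ j\<bar> \<le> r"
  shows "projector (sparse_set (card I)) y = projector {z. \<forall>j. j \<notin> I \<longrightarrow> z $ j = 0} y"
    (is "_ = projector ?L y")
proof -
  define q :: "real^'n" where "q = (\<chi> j. if j \<in> I then y $ j else 0)"
  have qL: "q \<in> ?L" by (simp add: q_def)
  have sub: "?L \<subseteq> sparse_set (card I)" by (rule coordinate_subspace_subset_sparse_set)
  have closer: "norm (y - q) < norm (y - z)" if "z \<in> sparse_set (card I)" "z \<notin> ?L" for z
    unfolding q_def using that large small by (intro coordinate_subspace_closer[where r = r]) auto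
  have le: "norm (y - x) \<le> norm (y - z)"
    if "x \<in> ?L" "\<forall>w. w \<in> ?L \<longrightarrow> norm (y - x) \<le> norm (y - w)" "z \<in> sparse_set (card I)" for x z
  proof (cases "z \<in> ?L")
    case False
    have "norm (y - x) \<le> norm (y - q)" using that(2) qL by blast
    then show ?thesis using closer[OF that(3) False] by simp
  qed (use that(2) in blast)
  have "x \<in> ?L"
    if "x \<in> sparse_set (card I)" "\<forall>w. w \<in> sparse_set (card I) \<longrightarrow> norm (y - x) \<le> norm (y - w)" for x
    using closer[OF that(1)] that(2) qL sub by (meson not_le subsetD)
  then have "is_arg_min (\<lambda>z. norm (y - z)) (\<lambda>z. z \<in> sparse_set (card I)) x \<longleftrightarrow>
        is_arg_min (\<lambda>z. norm (y - z)) (\<lambda>z. z \<in> ?L) x" for x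
    unfolding is_arg_min_linorder using sub le[of x] by blast
  then show ?thesis by (simp add: projector_def)
qed

lemma solution_set_eq_affine:
  assumes "a \<in> solution_set m M p"
  shows "solution_set m M p = (+) a ` solution_set m M (\<lambda>_. 0)"
proof -
  have "x \<in> solution_set m M p \<longleftrightarrow> x - a \<in> solution_set m M (\<lambda>_. 0)" for x
    using assms by (auto simp: solution_set_def right_diff_distrib sum_subtractf)
  moreover have "x \<in> (+) a ` V \<longleftrightarrow> x - a \<in> V" for x and V :: "(real^'a) set"
    by (auto intro!: image_eqI[of _ _ "x - a"])
  ultimately show ?thesis by blast
qed

lemma subspace_solution_set_zero: "subspace (solution_set m M (\<lambda>_. 0))"
proof -
  have "(\<Sum>j\<in>UNIV. M i $ j * (c * x $ j)) = c * (\<Sum>j\<in>UNIV. M i $ j * x $ j)" for i c x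
    by (simp add: sum_distrib_left mult.left_commute)
  then show ?thesis
    by (auto simp: subspace_def solution_set_def distrib_left sum.distrib)
qed

theorem theorem4p7:
  fixes m s :: nat
    and M :: "nat \<Rightarrow> real^'n"
    and p :: "nat \<Rightarrow> real"
    and xbar :: "real^'n"
    and \<delta> :: real
  assumes "m < CARD('n)"
    and "full_rank m M"
    and "s \<le> CARD('n)"
    and "sparse_set s \<inter> solution_set m M p \<noteq> {}"
    and "xbar \<in> sparse_set s \<inter> solution_set m M p"
    and "l0_norm xbar = s"
    and "0 < \<delta>"
    and "ereal \<delta> < (INF j\<in>{j. xbar $ j \<noteq> 0}. ereal \<bar>xbar $ j\<bar>)"
  shows "(\<forall>x :: nat \<Rightarrow> real^'n.
            x 0 \<in> cball xbar (\<delta>/2) \<and>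
            (\<forall>k. x (Suc k) \<in> douglas_rachford (sparse_set s) (solution_set m M p) (x k)) \<longrightarrow>
            converges_linearly_to x
              (Fix (douglas_rachford (sparse_set s) (solution_set m M p))))
       \<and> (\<forall>xhat \<in> Fix (douglas_rachford (sparse_set s) (solution_set m M p)) \<inter> cball xbar (\<delta>/2).
            \<exists>y \<in> sparse_set s \<inter> solution_set m M p. projector (solution_set m M p) xhat = {y})"
proof -
  let ?A = "sparse_set s :: (real^'n) set" and ?B = "solution_set m M p"
  define I where "I = {j. xbar $ j \<noteq> 0}"
  define L :: "(real^'n) set" where "L = {z. \<forall>j. j \<notin> I \<longrightarrow> z $ j = 0}"
  define N where "N = solution_set m M (\<lambda>_. 0)"
  have s: "s = card I" using assms(6) by (simp add: l0_norm_def I_def)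
  have subL: "subspace L" unfolding L_def by (rule subspace_coordinates)
  have subN: "subspace N" unfolding N_def by (rule subspace_solution_set_zero)
  have B: "?B = (+) xbar ` N" using assms(5) unfolding N_def by (intro solution_set_eq_affine) simp
  have xL: "xbar \<in> L" by (simp add: L_def I_def)
  have LA: "L \<subseteq> ?A" unfolding L_def s by (rule coordinate_subspace_subset_sparse_set)
  obtain PL where PL: "orthogonal_projector L PL" using orthogonal_projector_exists[OF subL] by blast
  obtain PN where PN: "orthogonal_projector N PN" using orthogonal_projector_exists[OF subN] by blast
  define RL where "RL x = 2 *\<^sub>R PL x - x" for x
  define RN where "RN x = 2 *\<^sub>R PN x - x" for x
  define S where "S = RL \<circ> RN"
  have RL: "orthogonal_transformation RL" and RN: "orthogonal_transformation RN"
    unfolding RL_def RN_def using PL PN by (auto intro: orthogonal_transformation_reflection)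
  have S: "orthogonal_transformation S"
    unfolding S_def using RL RN by (rule orthogonal_transformation_compose)
  \<comment> \<open>If \<open>xbar\<close> is zero, the infimum is over the empty set and infinite,
    and this claim is vacuous.\<close>
  have big: "\<delta> < \<bar>xbar $ j\<bar>" if "j \<in> I" for j
    using less_INF_D[OF assms(8)] that by (simp add: I_def)
  have projB: "projector ?B x = {xbar + PN (x - xbar)}" for x
    unfolding B by (rule projector_affine[OF subN PN])
  have reflB: "reflector ?B x = {xbar + RN (x - xbar)}" for x
    unfolding B RN_def by (rule reflector_affine[OF subN PN])
  \<comment> \<open>The separating threshold is \<open>\<delta>/2\<close>: entries on
    \<open>I\<close> exceed \<open>\<delta>\<close> at \<open>xbar\<close> and move by at most
    \<open>\<delta>/2\<close>, while entries off \<open>I\<close> start at 0.\<close>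
  have reflA: "reflector ?A y = {xbar + RL (y - xbar)}" if "norm (y - xbar) \<le> \<delta>/2" for y
  proof -
    have comp: "\<bar>y $ j - xbar $ j\<bar> \<le> \<delta>/2" for j
      using component_le_norm_cart[of "y - xbar" j] that by simp
    have "\<delta>/2 < \<bar>y $ j\<bar>" if "j \<in> I" for j
      using comp[of j] big[OF that] by linarith
    moreover have "\<bar>y $ j\<bar> \<le> \<delta>/2" if "j \<notin> I" for j
      using comp[of j] that by (simp add: I_def)
    ultimately have "projector ?A y = projector L y"
      unfolding s L_def by (intro projector_sparse_set)
    then have "reflector ?A y = reflector L y"
      by (simp add: reflector_def)
    \<comment> \<open>Since \<open>xbar\<close> lies in \<open>L\<close>, this reflection can be
      centred at \<open>xbar\<close> as well, just like the one in \<open>?B\<close>.\<close>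
    moreover have "L = (+) xbar ` L"
      using subL xL by (auto intro!: image_eqI[of _ _ "_ - xbar"] simp: subspace_add subspace_diff)
    ultimately show ?thesis
      using reflector_affine[OF subL PL, of xbar y] by (simp add: RL_def)
  qed
  have DR: "douglas_rachford ?A ?B x = {xbar + (1/2) *\<^sub>R (S (x - xbar) + (x - xbar))}"
    if "norm (x - xbar) \<le> \<delta>/2" for x
  proof -
    \<comment> \<open>The first reflection is an isometry about \<open>xbar\<close>, so its result
      is still in the ball where \<open>reflA\<close> applies.\<close>
    have "norm (RN (x - xbar)) \<le> \<delta>/2"
      using that orthogonal_transformation_norm[OF RN] by simp
    then have "reflector ?A (xbar + RN (x - xbar)) = {xbar + S (x - xbar)}"
      by (subst reflA) (simp_all add: S_def)
    moreover have "(1/2) *\<^sub>R (xbar + S (x - xbar) + x) = xbar + (1/2) *\<^sub>R (S (x - xbar) + (x - xbar))"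
    proof -
      have "xbar + S (x - xbar) + x = 2 *\<^sub>R xbar + (S (x - xbar) + (x - xbar))"
        by (simp add: scaleR_2)
      then show ?thesis by (simp only: scaleR_add_right scaleR_scaleR) simp
    qed
    ultimately show ?thesis by (simp add: douglas_rachford_def reflB)
  qed
  show ?thesis
  proof (intro conjI allI impI ballI)
    fix x :: "nat \<Rightarrow> real^'n"
    assume x: "x 0 \<in> cball xbar (\<delta>/2) \<and> (\<forall>k. x (Suc k) \<in> douglas_rachford ?A ?B (x k))"
    define v where "v k = x k - xbar" for k
    have v0: "norm (v 0) \<le> \<delta>/2"
      using x by (simp add: v_def dist_norm norm_minus_commute)
    have step_in_ball: "v (Suc k) = (1/2) *\<^sub>R (S (v k) + v k)" if "norm (v k) \<le> \<delta>/2" for k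
    proof -
      have "x (Suc k) \<in> {xbar + (1/2) *\<^sub>R (S (v k) + v k)}"
        using x DR[of "x k"] that unfolding v_def by blast
      then show ?thesis by (simp add: v_def)
    qed
    \<comment> \<open>The explicit step is valid only in the ball, and it keeps the next iterate
      there; the induction removes this condition from the step.\<close>
    have "norm (v k) \<le> \<delta>/2" for k
    proof (induction k)
      case (Suc k)
      then show ?case
        using norm_average_le[OF S, of "v k"] step_in_ball[OF Suc] by simp
    qed (rule v0)
    then have step: "v (Suc k) = (1/2) *\<^sub>R (S (v k) + v k)" for k
      using step_in_ball by blast
    obtain f c where f: "S f = f" "norm f \<le> norm (v 0)" and c: "0 \<le> c" "c < 1"
      and rate: "\<And>k. norm (v k - f) \<le> norm (v 0 - f) * c ^ k"
      using orthogonal_average_iterates[of S v, OF S step] by blast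
    \<comment> \<open>As \<open>norm f\<close> is at most \<open>norm (v 0)\<close>, this point is
      in the ball and \<open>DR\<close> evaluates there. It witnesses nonemptiness and bounds the
      distance to the fixed point set.\<close>
    have fixpt: "xbar + f \<in> Fix (douglas_rachford ?A ?B)"
      using DR[of "xbar + f"] f v0 by (simp add: Fix_def flip: scaleR_2)
    moreover have "infdist (x k) (Fix (douglas_rachford ?A ?B)) \<le> norm (v 0 - f) * c ^ k" for k
      using infdist_le[OF fixpt, of "x k"] rate[of k] by (simp add: v_def dist_norm algebra_simps)
    ultimately show "converges_linearly_to x (Fix (douglas_rachford ?A ?B))"
      using c norm_ge_zero[of "v 0 - f"] unfolding converges_linearly_to_def by blast
  next
    fix xhat
    assume xhat: "xhat \<in> Fix (douglas_rachford ?A ?B) \<inter> cball xbar (\<delta>/2)"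
    define v where "v = xhat - xbar"
    have "norm v \<le> \<delta>/2" using xhat by (simp add: v_def dist_norm norm_minus_commute)
    then have "xhat = xbar + (1/2) *\<^sub>R (S v + v)"
      using xhat DR[of xhat] by (auto simp: v_def Fix_def)
    then have "v = (1/2) *\<^sub>R (S v + v)"
      by (metis v_def add_diff_cancel_left')
    then have "2 *\<^sub>R v = S v + v" by (metis scaleR_half_double scaleR_2 scaleR_right_distrib)
    then have "S v = v" by (simp add: scaleR_2)
    \<comment> \<open>Read \<open>S v = v\<close> as
      \<open>2 *\<^sub>R PL (RN v) = RN v + v\<close>; the right side is twice \<open>PN v\<close>
      by definition of \<open>RN\<close>. So \<open>PN v\<close> is a value of
      \<open>PL\<close>.\<close>
    then have "2 *\<^sub>R PL (RN v) = 2 *\<^sub>R PN v"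
      by (simp add: S_def RL_def) (simp add: RN_def)
    then have "PN v \<in> L"
      using PL unfolding orthogonal_projector_def
      by (metis scaleR_cancel_left zero_neq_numeral)
    then have "xbar + PN v \<in> ?A" using LA subspace_add[OF subL xL] by blast
    moreover have "xbar + PN v \<in> ?B" using PN by (simp add: B orthogonal_projector_def)
    ultimately show "\<exists>y \<in> ?A \<inter> ?B. projector ?B xhat = {y}"
      using projB[of xhat] by (auto simp: v_def)
  qed
qed

end
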